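(* Let $\mathbf{v}$ be a smooth, nowhere zero vector field on an open set $U\subset\mathbb{R}^3$ and let $\mathbf{t}=\mathbf{v}/\|\mathbf{v}\|$. Write $\mathcal{H}_t=\mathbf{t}\cdot\nabla\times\mathbf{t}$. Then (locally) a unit vector field $\mathbf{n}$ orthogonal to $\mathbf{t}$, completing $\mathbf{t}$ to an orthonormal frame $(\mathbf{t},\mathbf{n},\mathbf{b})$ with $\mathbf{b}=\mathbf{t}\times\mathbf{n}$, can be chosen as follows. 1. If $(\nabla\times\mathbf{t})\times\mathbf{t}\neq\mathbf{0}$ (at every point of the region considered), let $$\mathbf{n}=\frac{(\nabla\times\mathbf{t})\times\mathbf{t}}{\|(\nabla\times\mathbf{t})\times\mathbf{t}\|};$$ then necessarily $\mathcal{H}_{nt}=\mathbf{n}\cdot\nabla\times\mathbf{t}=0$. 2. If $(\nabla\times\mathbf{t})\times\mathbf{t}=\mathbf{0}$ (identically), then $\nabla\times\mathbf{t}=\mathcal{H}_t\mathbf{t}$ and necessarily $\mathcal{H}_{nt}=\mathcal{H}_{bt}=0$, or equivalently $\partial_s\mathbf{t}=\mathbf{0}$. Moreover, in this case: (2a) if $\nabla\mathcal{H}_t\times\mathbf{t}\neq\mathbf{0}$, choose $$\mathbf{n}=\frac{\nabla\mathcal{H}_t\times\mathbf{t}}{\|\nabla\mathcal{H}_t\times\mathbf{t}\|};$$ (2b-i) if $\nabla\mathcal{H}_t\times\mathbf{t}=\mathbf{0}$ and $\mathcal{H}_t$ is a nonzero constant, then there exists a constant unit vector $\mathbf{a}$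 such that one may take $$\mathbf{n}=\frac{\mathbf{a}\times\mathbf{t}}{\|\mathbf{a}\times\mathbf{t}\|},$$ and hence $\mathcal{H}_{nt}=\mathcal{H}_{bt}=0$; (2b-ii) if $\nabla\mathcal{H}_t\times\mathbf{t}=\mathbf{0}$ and $\mathcal{H}_t=0$, then there exists a surface with unit normal $\mathbf{t}$, and the frame $(\mathbf{t},\mathbf{n},\mathbf{b})$ is taken to be the Darboux frame of the lines of curvature on this surface; one has $\mathcal{H}_{nt}=\mathcal{H}_{bt}=0$.
   Context: $\nabla\times$ is the curl in $\mathbb{R}^3$ with Cartesian coordinates. For an orthonormal frame $(\mathbf{t},\mathbf{n},\mathbf{b})$ with $\mathbf{t}=\mathbf{n}\times\mathbf{b}$, $\mathbf{n}=\mathbf{b}\times\mathbf{t}$, $\mathbf{b}=\mathbf{t}\times\mathbf{n}$, put $\mathcal{H}_t=\mathbf{t}\cdot\nabla\times\mathbf{t}$, $\mathcal{H}_{nt}=\mathbf{n}\cdot\nabla\times\mathbf{t}$, $\mathcal{H}_{bt}=\mathbf{b}\cdot\nabla\times\mathbf{t}$, and $\partial_s=\mathbf{t}\cdot\nabla$ (directional derivative along $\mathbf{t}$). The Darboux frame of the lines of curvature of a surface with unit normal $\mathbf{t}$ is the frame $(\mathbf{t},\mathbf{n},\mathbf{b})$ in which $\mathbf{n}$ is a unit tangent vector of a line of curvature, i.e. $\mathbf{n}\cdot\left(\mathbf{t}\times(\mathbf{n}\cdot\nabla)\mathbf{t}\right)=0$, and $\mathbf{b}=\mathbf{t}\times\mathbf{n}$.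 All assertions are local. *)

theory Defs
  imports "HOL-Analysis.Analysis"
begin

unbundle cross3_syntax

text \<open>All differential notions below use the Frechet derivative at interior points, so they are
  meant for open domains. The C^k condition asks for continuity of all iterated directional
  derivatives up to order k.\<close>

primrec Ck_on ::
  "nat \<Rightarrow> 'a::real_normed_vector set \<Rightarrow> ('a \<Rightarrow> 'b::real_normed_vector) \<Rightarrow> bool" where
  "Ck_on 0 S f \<longleftrightarrow> continuous_on S f"
| "Ck_on (Suc k) S f \<longleftrightarrow>
     (\<forall>x\<in>S. f differentiable (at x)) \<and>
     (\<forall>w. Ck_on k S (\<lambda>x. frechet_derivative f (at x) w))"

definition smooth_on ::
  "'a::real_normed_vector set \<Rightarrow> ('a \<Rightarrow> 'b::real_normed_vector) \<Rightarrow> bool" where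
  "smooth_on S f \<longleftrightarrow> (\<forall>k. Ck_on k S f)"

text \<open>\<open>dir_deriv w f x\<close> is the derivative of f at x along w, i.e. (w . nabla) f.\<close>

definition dir_deriv ::
  "'a::real_normed_vector \<Rightarrow> ('a \<Rightarrow> 'b::real_normed_vector) \<Rightarrow> 'a \<Rightarrow> 'b" where
  "dir_deriv w f x = frechet_derivative f (at x) w"

definition partial :: "3 \<Rightarrow> (real^3 \<Rightarrow> real) \<Rightarrow> real^3 \<Rightarrow> real" where
  "partial i f x = dir_deriv (axis i 1) f x"

definition gradient :: "(real^3 \<Rightarrow> real) \<Rightarrow> real^3 \<Rightarrow> real^3" where
  "gradient f x = vector [partial 1 f x, partial 2 f x, partial 3 f x]"

definition curl :: "(real^3 \<Rightarrow> real^3) \<Rightarrow> real^3 \<Rightarrow> real^3" where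
  "curl f x = vector
     [partial 2 (\<lambda>y. f y $ 3) x - partial 3 (\<lambda>y. f y $ 2) x,
      partial 3 (\<lambda>y. f y $ 1) x - partial 1 (\<lambda>y. f y $ 3) x,
      partial 1 (\<lambda>y. f y $ 2) x - partial 2 (\<lambda>y. f y $ 1) x]"

text \<open>\<open>hel n t\<close> is H_nt = n . curl t; in particular \<open>hel t t\<close> is H_t.\<close>

definition hel :: "(real^3 \<Rightarrow> real^3) \<Rightarrow> (real^3 \<Rightarrow> real^3) \<Rightarrow> real^3 \<Rightarrow> real" where
  "hel n t x = n x \<bullet> curl t x"

definition unit_field :: "(real^3 \<Rightarrow> real^3) \<Rightarrow> real^3 \<Rightarrow> real^3" where
  "unit_field w x = w x /\<^sub>R norm (w x)"

definition orthonormal_frame_on ::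
  "(real^3) set \<Rightarrow> (real^3 \<Rightarrow> real^3) \<Rightarrow> (real^3 \<Rightarrow> real^3) \<Rightarrow> (real^3 \<Rightarrow> real^3) \<Rightarrow> bool" where
  "orthonormal_frame_on W t n b \<longleftrightarrow> (\<forall>x\<in>W.
     norm (t x) = 1 \<and> norm (n x) = 1 \<and> norm (b x) = 1 \<and>
     t x \<bullet> n x = 0 \<and> t x \<bullet> b x = 0 \<and> n x \<bullet> b x = 0 \<and>
     t x = n x \<times> b x \<and> n x = b x \<times> t x \<and> b x = t x \<times> n x)"

definition smooth_frame_on ::
  "(real^3) set \<Rightarrow> (real^3 \<Rightarrow> real^3) \<Rightarrow> (real^3 \<Rightarrow> real^3) \<Rightarrow> (real^3 \<Rightarrow> real^3) \<Rightarrow> bool" where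
  "smooth_frame_on W t n b \<longleftrightarrow>
     orthonormal_frame_on W t n b \<and> smooth_on W t \<and> smooth_on W n \<and> smooth_on W b"

text \<open>Regular (embedded) surfaces in space, via local parametrizations that are smooth immersions
  and homeomorphisms onto relatively open pieces of the surface.\<close>

definition regular_surface :: "(real^3) set \<Rightarrow> bool" where
  "regular_surface S \<longleftrightarrow> (\<forall>p\<in>S. \<exists>V (D :: (real^2) set) X Y.
     open V \<and> p \<in> V \<and> open D \<and> smooth_on D X \<and>
     homeomorphism D (S \<inter> V) X Y \<and>
     (\<forall>u\<in>D. inj (frechet_derivative X (at u))))"

text \<open>Tangent vectors are the velocities of smooth curves lying in the surface.\<close>

definition tangent_vectors :: "(real^3) set \<Rightarrow> real^3 \<Rightarrow> (real^3) set" where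
  "tangent_vectors S p = {w. \<exists>e>0. \<exists>\<gamma> :: real \<Rightarrow> real^3.
     smooth_on {-e<..<e} \<gamma> \<and> \<gamma> ` {-e<..<e} \<subseteq> S \<and> \<gamma> 0 = p \<and>
     (\<gamma> has_vector_derivative w) (at 0)}"

definition unit_normal_on :: "(real^3) set \<Rightarrow> (real^3 \<Rightarrow> real^3) \<Rightarrow> bool" where
  "unit_normal_on S t \<longleftrightarrow>
     (\<forall>x\<in>S. norm (t x) = 1 \<and> (\<forall>w\<in>tangent_vectors S x. w \<bullet> t x = 0))"

text \<open>The Darboux frame of the lines of curvature of a surface S with unit normal t, where t is
  defined near S. The last equation says that n is a principal direction; it only involves
  derivatives of t tangent to S.\<close>

definition darboux_frame_on ::
  "(real^3) set \<Rightarrow> (real^3 \<Rightarrow> real^3) \<Rightarrow> (real^3 \<Rightarrow> real^3) \<Rightarrow> (real^3 \<Rightarrow> real^3) \<Rightarrow> bool" where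
  "darboux_frame_on S t n b \<longleftrightarrow>
     regular_surface S \<and> unit_normal_on S t \<and> orthonormal_frame_on S t n b \<and>
     (\<forall>x\<in>S. n x \<bullet> (t x \<times> dir_deriv (n x) t x) = 0)"

text \<open>Umbilic points: the derivative of the unit normal t acts as a scalar on tangent vectors.
  A field of principal directions need not be continuous at the boundary of the umbilic set.\<close>

definition umbilic_at :: "(real^3 \<Rightarrow> real^3) \<Rightarrow> real^3 \<Rightarrow> bool" where
  "umbilic_at t x \<longleftrightarrow> (\<exists>c. \<forall>w. w \<bullet> t x = 0 \<longrightarrow> dir_deriv w t x = c *\<^sub>R w)"

end

theory Submission
  imports Defs
begin

text \<open>
  Since $t$ has unit length, $(\<nabla> \<times> t) \<times> t = (t \<bullet> \<nabla>) t$ (\<open>curl_cross_unit\<close>). In an orthonormal frame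
  the components of this vector along $b$ and $n$ are, up to sign, $H_{nt}$ and $H_{bt}$
  (\<open>hel_eq_0_iff\<close>), which gives the equivalence of the two conditions in case 2. In cases 1, 2a
  and 2b-i the field $n$ is the normalization of a smooth nowhere zero field of the form $w \<times> t$;
  it is a unit field orthogonal to $t$, and everything else is algebra of the cross product
  (\<open>smooth_frame_unit_field_cross\<close>). In case 2b-i any constant vector $a$ that is not parallel to $t$ at
  the given point will do.

  Case 2b-ii carries the substance. There $\<nabla> \<times> t = H_t t = 0$, so the derivative of $t$ is symmetric
  (\<open>dir_deriv_symmetric\<close>) and $t$ has a local potential $\<phi>$ (\<open>symmetric_derivative_potential\<close>).
  The level sets of $\<phi>$ are regular surfaces with unit normal $t$ (\<open>level_surface_through\<close>), and the
  derivative of $t$ restricted to the plane orthogonal to $t$ is, up to sign, their shape operator.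
  A line of curvature has as tangent an eigenvector of this symmetric operator; one exists at every
  point (\<open>principal_direction_exists\<close>). It depends smoothly on the point where the eigenvalues are
  distinct, and it is arbitrary where they coincide on an open set (\<open>principal_field_near\<close>).
\<close>

section \<open>Calculus of smooth maps\<close>

lemma Ck_on_subset: "Ck_on k S f \<Longrightarrow> T \<subseteq> S \<Longrightarrow> Ck_on k T f"
proof (induction k arbitrary: f)
  case 0
  then show ?case by (simp add: continuous_on_subset)
next
  case (Suc k)
  then show ?case by (simp add: subset_iff)
qed

lemma Ck_on_cong:
  assumes "open S" "Ck_on k S f" "\<And>x. x \<in> S \<Longrightarrow> f x = g x"
  shows "Ck_on k S g"
  using assms(2,3)
proof (induction k arbitrary: f g)
  case 0
  then show ?case by (simp cong: continuous_on_cong)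
next
  case (Suc k)
  have d: "(g has_derivative frechet_derivative f (at x)) (at x)" if "x \<in> S" for x
    using Suc.prems that \<open>open S\<close>
    by (auto simp: frechet_derivative_works intro: has_derivative_transform_within_open)
  then have "frechet_derivative g (at x) = frechet_derivative f (at x)" if "x \<in> S" for x
    using that by (metis frechet_derivative_at)
  then have "Ck_on k S (\<lambda>x. frechet_derivative g (at x) w)" for w
    using Suc.IH[of "\<lambda>x. frechet_derivative f (at x) w"] Suc.prems by auto
  then show ?case
    using d by (auto simp: differentiable_def)
qed

text \<open>The derivative may be supplied as any function that is known to be the derivative, so closed
  formulas can be used in place of the derivative operator.\<close>

lemma Ck_on_SucI:
  assumes "open S" "\<And>x. x \<in> S \<Longrightarrow> (f has_derivative f' x) (at x)"
    and "\<And>w. Ck_on k S (\<lambda>x. f' x w)"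
  shows "Ck_on (Suc k) S f"
proof -
  have "f' x = frechet_derivative f (at x)" if "x \<in> S" for x
    using assms(2) that by (metis frechet_derivative_at)
  then have "Ck_on k S (\<lambda>x. frechet_derivative f (at x) w)" for w
    by (intro Ck_on_cong[OF \<open>open S\<close> assms(3)]) auto
  then show ?thesis
    using assms(2) by (auto simp: differentiable_def)
qed

lemma Ck_on_Suc_has_derivative:
  "Ck_on (Suc k) S f \<Longrightarrow> x \<in> S \<Longrightarrow> (f has_derivative frechet_derivative f (at x)) (at x)"
  by (simp add: frechet_derivative_works)

lemma Ck_on_SucD: "Ck_on (Suc k) S f \<Longrightarrow> Ck_on k S f"
proof (induction k arbitrary: f)
  case 0
  then have "\<forall>x\<in>S. f differentiable (at x)" by simp
  then have "f differentiable_on S"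
    unfolding differentiable_on_def by (blast intro: differentiable_at_withinI)
  then show ?case by (simp add: differentiable_imp_continuous_on)
next
  case (Suc k)
  note D = iffD1[OF Ck_on.simps(2) Suc.prems]
  show ?case
    by (rule iffD2[OF Ck_on.simps(2)], rule conjI[OF conjunct1[OF D]], rule allI, rule Suc.IH,
        rule spec[OF conjunct2[OF D]])
qed

lemma Ck_on_const: "Ck_on k S (\<lambda>x. c)"
proof (induction k arbitrary: c)
  case (Suc k)
  then show ?case by simp
qed simp

lemma Ck_on_bounded_linear:
  assumes "open S" "bounded_linear h"
  shows "Ck_on k S f \<Longrightarrow> Ck_on k S (\<lambda>x. h (f x))"
proof (induction k arbitrary: f)
  case 0
  then show ?case
    using assms(2) by (simp add: bounded_linear.continuous_on)
next
  case (Suc k)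
  show ?case
    by (rule Ck_on_SucI[OF \<open>open S\<close>])
      (use Suc in \<open>auto intro!: bounded_linear.has_derivative[OF assms(2)] Suc.IH
        Ck_on_Suc_has_derivative\<close>)
qed

lemma Ck_on_add:
  assumes "open S"
  shows "Ck_on k S f \<Longrightarrow> Ck_on k S g \<Longrightarrow> Ck_on k S (\<lambda>x. f x + g x)"
proof (induction k arbitrary: f g)
  case 0
  then show ?case by (simp add: continuous_on_add)
next
  case (Suc k)
  show ?case
    by (rule Ck_on_SucI[OF \<open>open S\<close>
          has_derivative_add[OF Ck_on_Suc_has_derivative Ck_on_Suc_has_derivative]])
      (use Suc in auto)
qed

lemma Ck_on_sum:
  assumes "open S" "\<And>i. i \<in> I \<Longrightarrow> Ck_on k S (f i)"
  shows "Ck_on k S (\<lambda>x. \<Sum>i\<in>I. f i x)"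
  using assms(2)
  by (induction I rule: infinite_finite_induct) (auto intro: Ck_on_const Ck_on_add[OF assms(1)])

lemma Ck_on_bounded_bilinear:
  assumes "open S" "bounded_bilinear h"
  shows "Ck_on k S f \<Longrightarrow> Ck_on k S g \<Longrightarrow> Ck_on k S (\<lambda>x. h (f x) (g x))"
proof (induction k arbitrary: f g)
  case 0
  then show ?case
    using assms(2) by (simp add: bounded_bilinear.continuous_on)
next
  case (Suc k)
  have fg: "Ck_on k S f" "Ck_on k S g"
    using Suc.prems by (blast intro: Ck_on_SucD)+
  show ?case
  proof (rule Ck_on_SucI[OF \<open>open S\<close>])
    fix x assume "x \<in> S"
    with Suc.prems show "((\<lambda>x. h (f x) (g x)) has_derivative
        (\<lambda>w. h (f x) (frechet_derivative g (at x) w) + h (frechet_derivative f (at x) w) (g x))) (at x)"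
      by (intro bounded_bilinear.FDERIV[OF assms(2)] Ck_on_Suc_has_derivative)
  next
    fix w
    from Suc.prems have "Ck_on k S (\<lambda>x. frechet_derivative f (at x) w)"
      and "Ck_on k S (\<lambda>x. frechet_derivative g (at x) w)"
      by simp_all
    with fg show "Ck_on k S (\<lambda>x. h (f x) (frechet_derivative g (at x) w)
        + h (frechet_derivative f (at x) w) (g x))"
      by (intro Ck_on_add[OF \<open>open S\<close>] Suc.IH)
  qed
qed

lemma Ck_on_compose:
  fixes g :: "'b::euclidean_space \<Rightarrow> 'c::real_normed_vector"
  assumes "open S" "open T" "f ` S \<subseteq> T"
  shows "Ck_on k S f \<Longrightarrow> Ck_on k T g \<Longrightarrow> Ck_on k S (\<lambda>x. g (f x))"
  using assms(3)
proof (induction k arbitrary: g)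
  case 0
  then show ?case by (simp add: continuous_on_compose2[of T g S f])
next
  case (Suc k)
  let ?Df = "\<lambda>x. frechet_derivative f (at x)" and ?Dg = "\<lambda>y. frechet_derivative g (at y)"
  \<comment> \<open>The direction in which g is differentiated varies with the point. Expanding it in the standard
    basis leaves directional derivatives of g along fixed vectors, to which the induction hypothesis
    applies.\<close>
  have D: "((\<lambda>x. g (f x)) has_derivative (\<lambda>w. \<Sum>b\<in>Basis. (?Df x w \<bullet> b) *\<^sub>R ?Dg (f x) b)) (at x)"
    if "x \<in> S" for x
  proof -
    have f: "(f has_derivative ?Df x) (at x)" and g: "(g has_derivative ?Dg (f x)) (at (f x))"
      using Suc.prems that by (auto simp: frechet_derivative_works)
    interpret linear "?Dg (f x)"
      using g by (rule has_derivative_linear)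
    have "?Dg (f x) v = (\<Sum>b\<in>Basis. (v \<bullet> b) *\<^sub>R ?Dg (f x) b)" for v
      using sum[of "\<lambda>b. (v \<bullet> b) *\<^sub>R b" Basis] unfolding euclidean_representation scaleR .
    then show ?thesis
      by (intro has_derivative_eq_rhs[OF has_derivative_compose[OF f g]] ext)
  qed
  have f: "Ck_on k S f"
    using Suc.prems by (blast intro: Ck_on_SucD)
  have Dg: "Ck_on k S (\<lambda>x. ?Dg (f x) b)" for b
    by (rule Suc.IH[OF f]) (use Suc.prems in auto)
  have Df: "Ck_on k S (\<lambda>x. ?Df x w)" for w
    using Suc.prems by simp
  show ?case
    by (intro Ck_on_SucI[OF \<open>open S\<close> D] Ck_on_sum[OF \<open>open S\<close>] Dg
        Ck_on_bounded_bilinear[OF \<open>open S\<close> bounded_bilinear_scaleR]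
        Ck_on_bounded_linear[OF \<open>open S\<close> bounded_linear_inner_left] Df) auto
qed

text \<open>Square roots and reciprocals of positive functions are both powers, and the derivative of a
  power is a multiple of a power, so one induction covers them.\<close>

lemma Ck_on_powr: "Ck_on k {0<..} (\<lambda>x::real. x powr a)"
proof (induction k arbitrary: a)
  case 0
  then show ?case by (auto intro!: continuous_intros)
next
  case (Suc k)
  have "((\<lambda>x. x powr a) has_derivative (\<lambda>w. a * x powr (a - 1) * w)) (at x)"
    if "x \<in> {0<..}" for x :: real
    using has_real_derivative_powr[of x a] that
    by (simp add: has_field_derivative_def)
  then show ?case
    by (rule Ck_on_SucI[OF open_greaterThan])
      (assumption | rule Ck_on_bounded_bilinear[OF _ bounded_bilinear_mult]
        Ck_on_const Suc open_greaterThan)+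
qed

lemma smooth_on_subset: "smooth_on S f \<Longrightarrow> T \<subseteq> S \<Longrightarrow> smooth_on T f"
  by (auto simp: smooth_on_def intro: Ck_on_subset)

lemma smooth_on_cong:
  "open S \<Longrightarrow> smooth_on S f \<Longrightarrow> (\<And>x. x \<in> S \<Longrightarrow> f x = g x) \<Longrightarrow> smooth_on S g"
  by (auto simp: smooth_on_def intro: Ck_on_cong)

lemma smooth_on_has_derivative:
  "smooth_on S f \<Longrightarrow> x \<in> S \<Longrightarrow> (f has_derivative frechet_derivative f (at x)) (at x)"
  using Ck_on_Suc_has_derivative[of 0] unfolding smooth_on_def by blast

lemma smooth_on_continuous_on: "smooth_on S f \<Longrightarrow> continuous_on S f"
  unfolding smooth_on_def by (drule spec[of _ 0]) simp

lemma smooth_on_dir_deriv: "smooth_on S f \<Longrightarrow> smooth_on S (\<lambda>x. dir_deriv w f x)"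
  unfolding smooth_on_def dir_deriv_def
  by (rule allI, drule spec[of _ "Suc _"], drule iffD1[OF Ck_on.simps(2)]) blast

lemma smooth_on_const: "smooth_on S (\<lambda>x. c)"
  by (simp add: smooth_on_def Ck_on_const)

lemma smooth_on_add:
  "open S \<Longrightarrow> smooth_on S f \<Longrightarrow> smooth_on S g \<Longrightarrow> smooth_on S (\<lambda>x. f x + g x)"
  by (simp add: smooth_on_def Ck_on_add)

lemma smooth_on_sum:
  "open S \<Longrightarrow> (\<And>i. i \<in> I \<Longrightarrow> smooth_on S (f i)) \<Longrightarrow> smooth_on S (\<lambda>x. \<Sum>i\<in>I. f i x)"
  by (simp add: smooth_on_def Ck_on_sum)

lemma smooth_on_bounded_linear:
  "open S \<Longrightarrow> bounded_linear h \<Longrightarrow> smooth_on S f \<Longrightarrow> smooth_on S (\<lambda>x. h (f x))"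
  by (simp add: smooth_on_def Ck_on_bounded_linear)

lemma smooth_on_bounded_bilinear:
  "open S \<Longrightarrow> bounded_bilinear h \<Longrightarrow> smooth_on S f \<Longrightarrow> smooth_on S g \<Longrightarrow>
    smooth_on S (\<lambda>x. h (f x) (g x))"
  by (simp add: smooth_on_def Ck_on_bounded_bilinear)

lemmas smooth_on_scaleR = smooth_on_bounded_bilinear[OF _ bounded_bilinear_scaleR]
lemmas smooth_on_mult = smooth_on_bounded_bilinear[OF _ bounded_bilinear_mult]
lemmas smooth_on_inner = smooth_on_bounded_bilinear[OF _ bounded_bilinear_inner]
lemmas smooth_on_vec_nth = smooth_on_bounded_linear[OF _ bounded_linear_vec_nth]

lemma bounded_bilinear_cross3: "bounded_bilinear (\<times>)"
  using bilinear_conv_bounded_bilinear bilinear_cross by blast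

lemmas smooth_on_cross = smooth_on_bounded_bilinear[OF _ bounded_bilinear_cross3]

lemma smooth_on_diff:
  "open S \<Longrightarrow> smooth_on S f \<Longrightarrow> smooth_on S g \<Longrightarrow> smooth_on S (\<lambda>x. f x - g x)"
  unfolding diff_conv_add_uminus
  by (intro smooth_on_add smooth_on_bounded_linear[OF _ bounded_linear_minus[OF bounded_linear_ident]])

lemma smooth_on_vector_3:
  fixes f g h :: "'a::real_normed_vector \<Rightarrow> real"
  assumes "open S" "smooth_on S f" "smooth_on S g" "smooth_on S h"
  shows "smooth_on S (\<lambda>x. vector [f x, g x, h x] :: real^3)"
proof -
  have "vector [a, b, c] = a *\<^sub>R axis 1 1 + b *\<^sub>R axis 2 1 + c *\<^sub>R (axis 3 1 :: real^3)" for a b c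
    by (simp add: vec_eq_iff forall_3 axis_def)
  with assms show ?thesis
    by (simp only:) (intro smooth_on_add smooth_on_scaleR smooth_on_const)
qed

lemma smooth_on_powr:
  fixes f :: "'a::real_normed_vector \<Rightarrow> real"
  assumes "open S" "smooth_on S f" "\<And>x. x \<in> S \<Longrightarrow> 0 < f x"
  shows "smooth_on S (\<lambda>x. f x powr a)"
  unfolding smooth_on_def
proof
  fix k
  have "f ` S \<subseteq> {0<..}"
    using assms(3) by auto
  then show "Ck_on k S (\<lambda>x. f x powr a)"
    using assms(2) unfolding smooth_on_def
    by (intro Ck_on_compose[OF \<open>open S\<close> open_greaterThan _ _ Ck_on_powr]) auto
qed

text \<open>Normalization is smooth away from the zeros because the norm enters as the power with exponent
  $-1/2$ of a smooth positive function.\<close>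

lemma smooth_on_unit_field:
  assumes "open S" "smooth_on S w" "\<And>x. x \<in> S \<Longrightarrow> w x \<noteq> 0"
  shows "smooth_on S (unit_field w)"
proof (rule smooth_on_cong[OF \<open>open S\<close>])
  show "smooth_on S (\<lambda>x. (w x \<bullet> w x) powr (-1/2) *\<^sub>R w x)"
    using assms by (intro smooth_on_scaleR smooth_on_powr smooth_on_inner) auto
  show "(w x \<bullet> w x) powr (-1/2) *\<^sub>R w x = unit_field w x" if "x \<in> S" for x
  proof -
    have "(w x \<bullet> w x) powr (-1/2) = inverse ((w x \<bullet> w x) powr (1/2))"
      using powr_minus[of "w x \<bullet> w x" "1/2"] by simp
    also have "\<dots> = inverse (norm (w x))"
      by (simp add: powr_half_sqrt norm_eq_sqrt_inner)
    finally show ?thesis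
      by (simp add: unit_field_def)
  qed
qed

lemma smooth_on_curl: "open S \<Longrightarrow> smooth_on S f \<Longrightarrow> smooth_on S (curl f)"
  unfolding curl_def[abs_def] partial_def
  by (intro smooth_on_vector_3 smooth_on_diff smooth_on_dir_deriv smooth_on_vec_nth)

lemma smooth_on_gradient: "open S \<Longrightarrow> smooth_on S f \<Longrightarrow> smooth_on S (gradient f)"
  unfolding gradient_def[abs_def] partial_def
  by (intro smooth_on_vector_3 smooth_on_dir_deriv)

lemma smooth_on_hel:
  "open S \<Longrightarrow> smooth_on S n \<Longrightarrow> smooth_on S t \<Longrightarrow> smooth_on S (hel n t)"
  unfolding hel_def[abs_def] by (intro smooth_on_inner smooth_on_curl)

section \<open>Curl of a unit field and orthonormal frames\<close>

text \<open>The curl is the antisymmetric part of the derivative. All the differential geometry below goes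
  through this identity: with $u$ and $w$ arbitrary it says that a field with zero curl has a
  symmetric derivative, and with $w = t$ it evaluates the cross product of curl and field.\<close>

lemma inner_curl_cross:
  assumes t: "(t has_derivative D) (at x)"
  shows "(curl t x \<times> w) \<bullet> u = u \<bullet> D w - w \<bullet> D u"
proof -
  interpret linear D using t by (rule has_derivative_linear)
  have p: "partial i (\<lambda>y. t y $ j) x = D (axis i 1) $ j" for i j
    using frechet_derivative_at[OF bounded_linear.has_derivative[OF bounded_linear_vec_nth t, of j], symmetric]
    by (simp add: partial_def dir_deriv_def)
  have "D w = w $ 1 *\<^sub>R D (axis 1 1) + w $ 2 *\<^sub>R D (axis 2 1) + w $ 3 *\<^sub>R D (axis 3 1)" for w
  proof -
    have "w = w $ 1 *\<^sub>R axis 1 1 + w $ 2 *\<^sub>R axis 2 1 + w $ 3 *\<^sub>R axis 3 1"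
      by (simp add: vec_eq_iff forall_3 axis_def)
    then show ?thesis by (metis add scaleR)
  qed
  note D = this[of w] this[of u]
  show ?thesis
    unfolding D curl_def p by (simp add: cross3_simps)
qed

text \<open>Differentiate $t \<bullet> t = 1$.\<close>

lemma unit_inner_derivative:
  assumes "(t has_derivative D) (at x)" "open W" "x \<in> W" "\<And>y. y \<in> W \<Longrightarrow> norm (t y) = 1"
  shows "t x \<bullet> D w = 0"
proof -
  have "((\<lambda>y. t y \<bullet> t y) has_derivative (\<lambda>w. t x \<bullet> D w + D w \<bullet> t x)) (at x)"
    using assms(1) by (rule has_derivative_inner[OF _ assms(1)])
  moreover have "((\<lambda>y. t y \<bullet> t y) has_derivative (\<lambda>w. 0)) (at x)"
    by (rule has_derivative_transform_within_open[OF has_derivative_const[of 1] assms(2,3)])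
      (simp add: assms(4) dot_square_norm)
  ultimately have "(\<lambda>w. t x \<bullet> D w + D w \<bullet> t x) = (\<lambda>w. 0)"
    by (rule has_derivative_unique)
  from fun_cong[OF this, of w] show ?thesis
    by (simp add: inner_commute)
qed

text \<open>In general $(\<nabla> \<times> t) \<times> t = (t \<bullet> \<nabla>) t - \<nabla>(t \<bullet> t)/2$, and the last term vanishes for a
  unit field.\<close>

lemma curl_cross_unit:
  assumes t: "(t has_derivative D) (at x)"
    and "open W" "x \<in> W" "\<And>y. y \<in> W \<Longrightarrow> norm (t y) = 1"
  shows "curl t x \<times> t x = D (t x)"
  by (rule vector_eq_ldot[THEN iffD1], rule allI)
    (metis inner_curl_cross[OF t] unit_inner_derivative[OF assms] diff_zero inner_commute)

lemma orthonormal_frameI: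
  assumes "\<And>x. x \<in> W \<Longrightarrow> norm (t x) = 1" "\<And>x. x \<in> W \<Longrightarrow> norm (n x) = 1"
    and "\<And>x. x \<in> W \<Longrightarrow> t x \<bullet> n x = 0"
  shows "orthonormal_frame_on W t n (\<lambda>x. t x \<times> n x)"
  unfolding orthonormal_frame_on_def
proof
  fix x assume "x \<in> W"
  then have 1: "t x \<bullet> t x = 1" "n x \<bullet> n x = 1" "t x \<bullet> n x = 0"
    using assms by (auto simp: dot_square_norm)
  have "(norm (t x \<times> n x))\<^sup>2 = 1"
    using norm_cross_dot[of "t x" "n x"] assms[OF \<open>x \<in> W\<close>] by simp
  then have "norm (t x \<times> n x) = 1"
    using power2_eq_1_iff[of "norm (t x \<times> n x)"] norm_ge_zero[of "t x \<times> n x"] by linarith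
  then show "norm (t x) = 1 \<and> norm (n x) = 1 \<and> norm (t x \<times> n x) = 1 \<and>
     t x \<bullet> n x = 0 \<and> t x \<bullet> (t x \<times> n x) = 0 \<and> n x \<bullet> (t x \<times> n x) = 0 \<and>
     t x = n x \<times> (t x \<times> n x) \<and> n x = (t x \<times> n x) \<times> t x \<and> t x \<times> n x = t x \<times> n x"
    using assms[OF \<open>x \<in> W\<close>] 1 cross_skew[of "t x \<times> n x" "t x"]
    by (simp add: Lagrange dot_cross_self inner_commute)
qed

lemma smooth_frameI:
  assumes "open W" "smooth_on W t" "smooth_on W n"
    and "\<And>x. x \<in> W \<Longrightarrow> norm (t x) = 1" "\<And>x. x \<in> W \<Longrightarrow> norm (n x) = 1"
    and "\<And>x. x \<in> W \<Longrightarrow> t x \<bullet> n x = 0"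
  shows "smooth_frame_on W t n (\<lambda>x. t x \<times> n x)"
  using assms by (simp add: smooth_frame_on_def orthonormal_frameI smooth_on_cross)

lemma smooth_frame_unit_field_cross:
  assumes "open W" "smooth_on W t" "\<And>x. x \<in> W \<Longrightarrow> norm (t x) = 1"
    and "smooth_on W w" "\<And>x. x \<in> W \<Longrightarrow> w x \<times> t x \<noteq> 0"
  shows "smooth_frame_on W t (unit_field (\<lambda>x. w x \<times> t x)) (\<lambda>x. t x \<times> unit_field (\<lambda>x. w x \<times> t x) x)"
  using assms
  by (intro smooth_frameI smooth_on_unit_field smooth_on_cross)
    (auto simp: unit_field_def dot_cross_self)

lemma frame_cross_expansion:
  assumes "orthonormal_frame_on W t n b" "x \<in> W"
  shows "c \<times> t x = (c \<bullet> b x) *\<^sub>R n x - (c \<bullet> n x) *\<^sub>R b x"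
proof -
  have "t x = n x \<times> b x"
    using assms unfolding orthonormal_frame_on_def by blast
  then show ?thesis by (simp only: Lagrange)
qed

text \<open>The two helicities are, up to sign, the components of $(\<nabla> \<times> t) \<times> t$ along $b$ and $n$.\<close>

lemma hel_eq_0_iff:
  assumes "orthonormal_frame_on W t n b" "x \<in> W"
  shows "hel n t x = 0 \<and> hel b t x = 0 \<longleftrightarrow> curl t x \<times> t x = 0"
proof
  assume "hel n t x = 0 \<and> hel b t x = 0"
  then show "curl t x \<times> t x = 0"
    unfolding frame_cross_expansion[OF assms] by (simp add: hel_def inner_commute)
next
  assume 0: "curl t x \<times> t x = 0"
  have "norm (n x) = 1" "norm (b x) = 1" "n x \<bullet> b x = 0"
    using assms unfolding orthonormal_frame_on_def by blast+
  then have o: "n x \<bullet> n x = 1" "b x \<bullet> b x = 1" "n x \<bullet> b x = 0"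
    by (simp_all add: dot_square_norm)
  from arg_cong[OF 0, of "\<lambda>v. v \<bullet> n x"] arg_cong[OF 0, of "\<lambda>v. v \<bullet> b x"] o
  show "hel n t x = 0 \<and> hel b t x = 0"
    unfolding frame_cross_expansion[OF assms]
    by (simp add: hel_def inner_diff_left inner_diff_right inner_commute)
qed

lemma parallel_to_unit:
  fixes c t :: "real^3"
  assumes "norm t = 1" "c \<times> t = 0"
  shows "c = (t \<bullet> c) *\<^sub>R t"
proof -
  have "t \<times> (c \<times> t) = (t \<bullet> t) *\<^sub>R c - (t \<bullet> c) *\<^sub>R t"
    by (simp only: Lagrange)
  with assms show ?thesis by (simp add: dot_square_norm)
qed

lemma exists_not_parallel:
  fixes t :: "real^3"
  assumes "norm t = 1"
  obtains a where "norm a = 1" "a \<times> t \<noteq> 0"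
proof -
  have "t \<noteq> 0" using assms by auto
  then obtain i where "t \<times> axis i 1 \<noteq> 0"
    using cross_basis_nonzero by blast
  then have "axis i 1 \<times> t \<noteq> 0"
    by (subst cross_skew) simp
  then show ?thesis using that by (metis norm_axis_1)
qed

section \<open>Potentials of fields with symmetric derivative\<close>

text \<open>The Poincare lemma for one-forms. The potential is the line integral of the field along the
  segments issuing from $p$. Differentiating under the integral sign, symmetry of the derivative turns
  the integrand into the derivative of $s \<mapsto> s \<cdot> (t(\<gamma>(s)) \<bullet> h)$, so the integral is $t(x) \<bullet> h$.\<close>

lemma symmetric_derivative_potential:
  fixes t :: "'a::euclidean_space \<Rightarrow> 'a"
  assumes "open B" "convex B" "p \<in> B" and t: "smooth_on B t"
    and sym: "\<And>x u w. x \<in> B \<Longrightarrow> u \<bullet> dir_deriv w t x = w \<bullet> dir_deriv u t x"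
  obtains \<phi> where "\<And>x. x \<in> B \<Longrightarrow> (\<phi> has_derivative (\<lambda>h. t x \<bullet> h)) (at x)"
proof
  define \<gamma> where "\<gamma> x s = p + s *\<^sub>R (x - p)" for x and s :: real
  define \<phi> where "\<phi> x = integral (cbox 0 1) (\<lambda>s. t (\<gamma> x s) \<bullet> (x - p))" for x
  define f' where "f' x s = Blinfun (\<lambda>h. t (\<gamma> x s) \<bullet> h + (s *\<^sub>R dir_deriv h t (\<gamma> x s)) \<bullet> (x - p))" for x s
  have \<gamma>: "\<gamma> x s \<in> B" if "x \<in> B" "s \<in> cbox 0 1" for x s
  proof -
    have "\<gamma> x s = (1 - s) *\<^sub>R p + s *\<^sub>R x"
      by (simp add: \<gamma>_def algebra_simps)
    then show ?thesis
      using convexD[OF \<open>convex B\<close> \<open>p \<in> B\<close> \<open>x \<in> B\<close>, of "1 - s" s] that by simp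
  qed
  have D: "(t has_derivative (\<lambda>h. dir_deriv h t y)) (at y)" if "y \<in> B" for y
    using smooth_on_has_derivative[OF t that] by (simp add: dir_deriv_def)
  note bl = has_derivative_bounded_linear[OF D]
  have scale: "dir_deriv (c *\<^sub>R h) t y = c *\<^sub>R dir_deriv h t y" if "y \<in> B" for c h y
    using linear_scale[OF bounded_linear.linear[OF bl[OF that]]] .
  have f': "blinfun_apply (f' x s) = (\<lambda>h. t (\<gamma> x s) \<bullet> h + (s *\<^sub>R dir_deriv h t (\<gamma> x s)) \<bullet> (x - p))"
    if "x \<in> B" "s \<in> cbox 0 1" for x s
    unfolding f'_def
    by (rule bounded_linear_Blinfun_apply)
      (intro bounded_linear_add bounded_linear_inner_right bounded_linear_inner_left_comp
        bounded_linear_scaleR_const bounded_linear_const_scaleR bl \<gamma> that)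
  have cont: "continuous_on (SIGMA x:B. cbox 0 1) (\<lambda>(x, s). f' x s)"
  proof (rule continuous_on_blinfun_componentwise)
    fix i :: 'a
    have c: "continuous_on (SIGMA x:B. cbox 0 1) (\<lambda>z. g (\<gamma> (fst z) (snd z)))" if "smooth_on B g" for g :: "'a \<Rightarrow> 'a"
      by (rule continuous_on_compose2[OF smooth_on_continuous_on[OF that]])
        (auto simp: \<gamma> \<gamma>_def[abs_def] intro!: continuous_intros, metis \<gamma> \<gamma>_def cbox_interval atLeastAtMost_iff)
    have "continuous_on (SIGMA x:B. cbox 0 1) (\<lambda>z. t (\<gamma> (fst z) (snd z)) \<bullet> i
        + (snd z *\<^sub>R dir_deriv i t (\<gamma> (fst z) (snd z))) \<bullet> (fst z - p))"
      by (intro continuous_intros c smooth_on_dir_deriv t)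
    then show "continuous_on (SIGMA x:B. cbox 0 1) (\<lambda>z. (case z of (x, s) \<Rightarrow> f' x s) i)"
      by (rule continuous_on_eq) (auto simp: f' split: prod.splits)
  qed
  fix x assume x: "x \<in> B"
  have "(\<phi> has_derivative integral (cbox 0 1) (f' x)) (at x within B)"
    unfolding \<phi>_def
  proof (rule leibniz_rule[OF _ _ cont x \<open>convex B\<close>])
    fix y and s :: real assume y: "y \<in> B" and s: "s \<in> cbox 0 1"
    have "((\<lambda>y. \<gamma> y s) has_derivative (\<lambda>h. s *\<^sub>R h)) (at y)"
      unfolding \<gamma>_def by (auto intro!: derivative_eq_intros)
    from has_derivative_compose[OF this D[OF \<gamma>[OF y s]]]
    have "((\<lambda>y. t (\<gamma> y s)) has_derivative (\<lambda>h. s *\<^sub>R dir_deriv h t (\<gamma> y s))) (at y)"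
      by (simp add: scale \<gamma>[OF y s])
    then have "((\<lambda>y. t (\<gamma> y s) \<bullet> (y - p)) has_derivative
        (\<lambda>h. t (\<gamma> y s) \<bullet> h + (s *\<^sub>R dir_deriv h t (\<gamma> y s)) \<bullet> (y - p))) (at y)"
      by (auto intro!: derivative_eq_intros)
    then show "((\<lambda>y. t (\<gamma> y s) \<bullet> (y - p)) has_derivative blinfun_apply (f' y s)) (at y within B)"
      unfolding f'[OF y s] by (rule has_derivative_at_withinI)
  next
    fix y assume y: "y \<in> B"
    have "continuous_on (cbox 0 1) (\<lambda>s. t (\<gamma> y s))"
      by (rule continuous_on_compose2[OF smooth_on_continuous_on[OF t]])
        (use \<gamma>[OF y] in \<open>auto simp: \<gamma>_def intro!: continuous_intros\<close>)
    then show "(\<lambda>s. t (\<gamma> y s) \<bullet> (y - p)) integrable_on cbox 0 1"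
      by (intro integrable_continuous continuous_intros)
  qed
  then have "(\<phi> has_derivative integral (cbox 0 1) (f' x)) (at x)"
    using at_within_open[OF x \<open>open B\<close>] by simp
  moreover have "blinfun_apply (integral (cbox 0 1) (f' x)) h = t x \<bullet> h" for h
  proof -
    have "continuous_on (cbox 0 1) (\<lambda>s. case (x, s) of (x, s) \<Rightarrow> f' x s)"
      by (rule continuous_on_compose2[OF cont]) (use x in \<open>auto intro!: continuous_intros\<close>)
    then have "f' x integrable_on cbox 0 1"
      by (intro integrable_continuous) simp
    then have "blinfun_apply (integral (cbox 0 1) (f' x)) h = integral (cbox 0 1) (\<lambda>s. f' x s h)"
      by (rule blinfun_apply_integral)
    \<comment> \<open>The left end of the segment contributes nothing because of the factor s.\<close>
    moreover have "((\<lambda>s. f' x s h) has_integral (1 *\<^sub>R (t (\<gamma> x 1) \<bullet> h) - 0 *\<^sub>R (t (\<gamma> x 0) \<bullet> h))) {0..1}"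
    proof (rule fundamental_theorem_of_calculus)
      fix s :: real assume s: "s \<in> {0..1}"
      have "(\<gamma> x has_derivative (\<lambda>r. r *\<^sub>R (x - p))) (at s)"
        unfolding \<gamma>_def by (auto intro!: derivative_eq_intros)
      from has_derivative_compose[OF this D[OF \<gamma>[OF x]]] s
      have "((\<lambda>s. t (\<gamma> x s)) has_derivative (\<lambda>r. r *\<^sub>R dir_deriv (x - p) t (\<gamma> x s))) (at s)"
        by (simp add: scale \<gamma>[OF x])
      then have "((\<lambda>s. s *\<^sub>R (t (\<gamma> x s) \<bullet> h)) has_derivative
          (\<lambda>r. r *\<^sub>R (t (\<gamma> x s) \<bullet> h + s * (h \<bullet> dir_deriv (x - p) t (\<gamma> x s))))) (at s)"
        by (auto intro!: derivative_eq_intros simp: algebra_simps inner_commute)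
      moreover have "f' x s h = t (\<gamma> x s) \<bullet> h + s * (h \<bullet> dir_deriv (x - p) t (\<gamma> x s))"
        using s f'[OF x, of s] sym[OF \<gamma>[OF x], of s "x - p" h] by (simp add: inner_commute)
      ultimately show "((\<lambda>s. s *\<^sub>R (t (\<gamma> x s) \<bullet> h)) has_vector_derivative f' x s h) (at s within {0..1})"
        by (simp add: has_vector_derivative_def has_derivative_at_withinI)
    qed simp
    ultimately show ?thesis
      by (simp add: integral_unique \<gamma>_def)
  qed
  ultimately show "(\<phi> has_derivative (\<lambda>h. t x \<bullet> h)) (at x)"
    by (metis (no_types, lifting) ext)
qed

section \<open>Level surfaces of a potential\<close>

text \<open>The Lagrange identity, applied to $e_2 \<times> (w \<times> e_2)$ with $e_2 = t \<times> e_1$.\<close>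

lemma orthonormal_triple_expansion:
  fixes e\<^sub>1 t :: "real^3"
  assumes "norm t = 1" "norm e\<^sub>1 = 1" "t \<bullet> e\<^sub>1 = 0"
  shows "w = (e\<^sub>1 \<bullet> w) *\<^sub>R e\<^sub>1 + ((t \<times> e\<^sub>1) \<bullet> w) *\<^sub>R (t \<times> e\<^sub>1) + (t \<bullet> w) *\<^sub>R t"
proof -
  have 1: "t \<bullet> t = 1" "e\<^sub>1 \<bullet> e\<^sub>1 = 1"
    using assms by (simp_all add: dot_square_norm)
  have "(t \<times> e\<^sub>1) \<times> (w \<times> (t \<times> e\<^sub>1)) = ((t \<times> e\<^sub>1) \<bullet> (t \<times> e\<^sub>1)) *\<^sub>R w - ((t \<times> e\<^sub>1) \<bullet> w) *\<^sub>R (t \<times> e\<^sub>1)"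
    by (rule Lagrange)
  moreover have "w \<times> (t \<times> e\<^sub>1) = (w \<bullet> e\<^sub>1) *\<^sub>R t - (w \<bullet> t) *\<^sub>R e\<^sub>1"
    by (rule Lagrange)
  moreover have "(t \<times> e\<^sub>1) \<times> t = e\<^sub>1" "(t \<times> e\<^sub>1) \<times> e\<^sub>1 = - t"
    using cross_skew[of "t \<times> e\<^sub>1" t] cross_skew[of "t \<times> e\<^sub>1" e\<^sub>1] 1 assms(3)
    by (simp_all add: Lagrange inner_commute)
  moreover have "(t \<times> e\<^sub>1) \<bullet> (t \<times> e\<^sub>1) = 1"
    using norm_cross_dot[of t e\<^sub>1] assms by (simp add: power2_norm_eq_inner)
  ultimately show ?thesis
    by (simp add: cross_mult_right Cross3.right_diff_distrib inner_commute algebra_simps)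
qed

text \<open>The surface is a piece of a level set of the potential, written as a graph over the plane through
  $q$ orthogonal to $t(q)$. The inverse function theorem yields a differentiable parametrization.
  Its derivative is an explicit smooth expression in the value of the parametrization itself, so
  smoothness follows by bootstrapping. The field is normal to the surface because the potential is
  constant along every curve in the surface.\<close>

lemma level_surface_through:
  fixes t :: "real^3 \<Rightarrow> real^3" and \<phi> :: "real^3 \<Rightarrow> real"
  assumes "open V" "q \<in> V" and t: "smooth_on V t" and unit: "\<And>x. x \<in> V \<Longrightarrow> norm (t x) = 1"
    and \<phi>: "\<And>x. x \<in> V \<Longrightarrow> (\<phi> has_derivative (\<lambda>h. t x \<bullet> h)) (at x)"
  obtains S where "q \<in> S" "S \<subseteq> V" "regular_surface S" "unit_normal_on S t"
proof -
  define e\<^sub>3 where "e\<^sub>3 = t q"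
  have e\<^sub>3: "norm e\<^sub>3 = 1"
    using unit[OF \<open>q \<in> V\<close>] by (simp add: e\<^sub>3_def)
  obtain a where a: "norm a = 1" "a \<times> e\<^sub>3 \<noteq> 0"
    using exists_not_parallel[OF e\<^sub>3] .
  define e\<^sub>1 where "e\<^sub>1 = (a \<times> e\<^sub>3) /\<^sub>R norm (a \<times> e\<^sub>3)"
  have e\<^sub>1: "norm e\<^sub>1 = 1" "e\<^sub>3 \<bullet> e\<^sub>1 = 0"
    using a by (simp_all add: e\<^sub>1_def dot_cross_self)
  define e\<^sub>2 where "e\<^sub>2 = e\<^sub>3 \<times> e\<^sub>1"
  have e\<^sub>2: "norm e\<^sub>2 = 1" "e\<^sub>1 \<bullet> e\<^sub>2 = 0" "e\<^sub>3 \<bullet> e\<^sub>2 = 0"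
    using orthonormal_frameI[of "{q}" "\<lambda>_. e\<^sub>3" "\<lambda>_. e\<^sub>1"] e\<^sub>1 e\<^sub>3
    by (auto simp: orthonormal_frame_on_def e\<^sub>2_def)
  note ip = e\<^sub>1(2) e\<^sub>2(2,3) e\<^sub>1(2)[unfolded inner_commute[of e\<^sub>3]]
    e\<^sub>2(2)[unfolded inner_commute[of e\<^sub>1]] e\<^sub>2(3)[unfolded inner_commute[of e\<^sub>3]]
  have sq: "e\<^sub>1 \<bullet> e\<^sub>1 = 1" "e\<^sub>2 \<bullet> e\<^sub>2 = 1" "e\<^sub>3 \<bullet> e\<^sub>3 = 1"
    using e\<^sub>1 e\<^sub>2 e\<^sub>3 by (simp_all add: dot_square_norm)
  \<comment> \<open>Where the field has a positive component along its value at q, the level sets are graphs.\<close>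
  define V' where "V' = V \<inter> (\<lambda>x. t x \<bullet> e\<^sub>3) -` {0<..}"
  have V': "open V'" "q \<in> V'" "V' \<subseteq> V"
    unfolding V'_def using \<open>open V\<close> \<open>q \<in> V\<close> sq
    by (auto intro!: continuous_open_preimage continuous_intros smooth_on_continuous_on[OF t]
        simp: e\<^sub>3_def)
  have pos: "0 < t x \<bullet> e\<^sub>3" if "x \<in> V'" for x
    using that by (simp add: V'_def)
  define P where "P u = u $ 1 *\<^sub>R e\<^sub>1 + u $ 2 *\<^sub>R e\<^sub>2" for u :: "real^2"
  have P: "bounded_linear P"
    unfolding P_def by (intro bounded_linear_add bounded_linear_scaleR_const bounded_linear_vec_nth)
  define Y where "Y x = (vector [e\<^sub>1 \<bullet> (x - q), e\<^sub>2 \<bullet> (x - q)] :: real^2)" for x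
  \<comment> \<open>F replaces the coordinate along the third vector by the increment of the potential. Its
    derivative at q is the identity because the gradient of the potential at q is the third vector.\<close>
  define F where "F x = (x - q) + ((\<phi> x - \<phi> q) - e\<^sub>3 \<bullet> (x - q)) *\<^sub>R e\<^sub>3" for x
  define F' where "F' x = Blinfun (\<lambda>h. h + ((t x - e\<^sub>3) \<bullet> h) *\<^sub>R e\<^sub>3)" for x
  have F': "blinfun_apply (F' x) = (\<lambda>h. h + ((t x - e\<^sub>3) \<bullet> h) *\<^sub>R e\<^sub>3)" for x
    unfolding F'_def
    by (rule bounded_linear_Blinfun_apply)
      (intro bounded_linear_add bounded_linear_ident bounded_linear_scaleR_const
        bounded_linear_inner_right)
  have dF: "(F has_derivative blinfun_apply (F' x)) (at x)" if "x \<in> V'" for x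
    unfolding F' F_def
    by (rule derivative_eq_intros \<phi> refl | use that V' in \<open>auto simp: algebra_simps\<close>)+
  have cF: "continuous_on V' F'"
    by (rule continuous_on_blinfun_componentwise, unfold F')
      (intro continuous_intros continuous_on_subset[OF smooth_on_continuous_on[OF t] V'(3)])
  have id: "id_blinfun o\<^sub>L F' q = id_blinfun"
    by (rule blinfun_eqI) (simp add: F' e\<^sub>3_def)
  obtain U O' g g' where U: "open U" "U \<subseteq> V'" "q \<in> U" and O': "open O'" "F q \<in> O'"
    and hom: "homeomorphism U O' F g"
    and g: "\<And>y. y \<in> O' \<Longrightarrow> (g has_derivative g' y) (at y)"
    by (rule inverse_function_theorem[OF V'(1) dF cF V'(2) id]) blast+
  define D where "D = P -` O'"
  define X where "X u = g (P u)" for u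
  define S where "S = X ` D"
  have "open D"
    unfolding D_def using O' bounded_linear.continuous_on[OF P continuous_on_id, of UNIV]
    by (simp add: open_vimage)
  have XV: "X u \<in> V'" if "u \<in> D" for u
    using that hom U by (auto simp: X_def D_def homeomorphism_def)
  have FX: "F (X u) = P u" if "u \<in> D" for u
    using that hom by (simp add: X_def D_def homeomorphism_def)
  have \<phi>X: "\<phi> (X u) = \<phi> q" if "u \<in> D" for u
    using arg_cong[OF FX[OF that], of "\<lambda>v. e\<^sub>3 \<bullet> v"] sq ip
    by (simp add: F_def P_def inner_add_right)
  have YX: "Y (X u) = u" if "u \<in> D" for u
    using arg_cong[OF FX[OF that], of "\<lambda>v. e\<^sub>1 \<bullet> v"] arg_cong[OF FX[OF that], of "\<lambda>v. e\<^sub>2 \<bullet> v"] sq ip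
    by (simp add: Y_def F_def P_def inner_add_right vec_eq_iff forall_2)
  have F0: "F q = P 0"
    by (simp add: F_def P_def)
  have q: "0 \<in> D" "X 0 = q"
    using O' U hom by (simp_all add: D_def X_def F0[symmetric] homeomorphism_def)
  define X' where "X' u w = P w - ((t (X u) \<bullet> P w) * (t (X u) \<bullet> e\<^sub>3) powr (-1)) *\<^sub>R e\<^sub>3" for u w
  \<comment> \<open>Y recovers u from X u, which fixes the components of the derivative along the first two vectors;
    the third one follows because the potential is constant along X.\<close>
  have dX: "(X has_derivative X' u) (at u)" if u: "u \<in> D" for u
  proof -
    have "P u \<in> O'" using u by (simp add: D_def)
    define L where "L = (\<lambda>w. g' (P u) (P w))"
    have L: "(X has_derivative L) (at u)"
      unfolding X_def L_def
      by (rule has_derivative_compose[OF bounded_linear.has_derivative[OF P has_derivative_ident] g])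
        (rule \<open>P u \<in> O'\<close>)
    have comp: "e \<bullet> L w = w $ i" if "\<And>u. u \<in> D \<Longrightarrow> e \<bullet> (X u - q) = u $ i" for e i w
    proof -
      have "((\<lambda>u. e \<bullet> (X u - q)) has_derivative (\<lambda>w. e \<bullet> L w)) (at u)"
        by (auto intro!: derivative_eq_intros L)
      moreover have "((\<lambda>u. e \<bullet> (X u - q)) has_derivative (\<lambda>w. w $ i)) (at u)"
        by (rule has_derivative_transform_within_open[OF _ \<open>open D\<close> u])
          (auto simp: that intro!: bounded_linear.has_derivative[OF bounded_linear_vec_nth] has_derivative_ident)
      ultimately show ?thesis
        by (metis has_derivative_unique)
    qed
    have "e\<^sub>1 \<bullet> (X u - q) = u $ 1" "e\<^sub>2 \<bullet> (X u - q) = u $ 2" if "u \<in> D" for u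
      using YX[OF that] by (auto simp: Y_def vec_eq_iff forall_2)
    then have e: "e\<^sub>1 \<bullet> L w = w $ 1" "e\<^sub>2 \<bullet> L w = w $ 2" for w
      by (auto intro: comp)
    have "((\<lambda>u. \<phi> (X u)) has_derivative (\<lambda>w. t (X u) \<bullet> L w)) (at u)"
      using XV[OF u] V' by (intro has_derivative_compose[OF L \<phi>]) auto
    moreover have "((\<lambda>u. \<phi> (X u)) has_derivative (\<lambda>w. 0)) (at u)"
      by (rule has_derivative_transform_within_open[OF has_derivative_const \<open>open D\<close> u]) (simp add: \<phi>X)
    ultimately have "(\<lambda>w. t (X u) \<bullet> L w) = (\<lambda>w. 0)"
      by (rule has_derivative_unique)
    then have tL: "t (X u) \<bullet> L w = 0" for w
      by (rule fun_cong)
    have "L w = X' u w" for w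
    proof -
      have Lw: "L w = P w + (e\<^sub>3 \<bullet> L w) *\<^sub>R e\<^sub>3"
        using orthonormal_triple_expansion[OF e\<^sub>3 e\<^sub>1, of "L w"]
        unfolding e\<^sub>2_def[symmetric] e P_def .
      have "t (X u) \<bullet> P w + (e\<^sub>3 \<bullet> L w) * (t (X u) \<bullet> e\<^sub>3) = 0"
        using tL[of w] by (subst (asm) Lw) (simp add: inner_add_right)
      then have "e\<^sub>3 \<bullet> L w = - ((t (X u) \<bullet> P w) * (t (X u) \<bullet> e\<^sub>3) powr (-1))"
        using pos[OF XV[OF u]] by (simp add: powr_minus field_simps)
      with Lw show ?thesis by (simp add: X'_def)
    qed
    with L show ?thesis by (metis (no_types, lifting) ext)
  qed
  have "Ck_on k D X" for k
  proof (induction k)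
    case 0
    then show ?case
      using dX by (auto intro!: continuous_at_imp_continuous_on has_derivative_continuous)
  next
    case (Suc k)
    have tX: "Ck_on k D (\<lambda>u. t (X u))"
      by (rule Ck_on_compose[OF \<open>open D\<close> \<open>open V\<close> _ Suc])
        (use XV V' t in \<open>auto simp: smooth_on_def\<close>)
    have "Ck_on k D (\<lambda>u. (t (X u) \<bullet> e\<^sub>3) powr (-1))"
      by (rule Ck_on_compose[OF \<open>open D\<close> open_greaterThan _ _ Ck_on_powr])
        (use pos XV in \<open>auto intro: Ck_on_bounded_linear[OF \<open>open D\<close> bounded_linear_inner_left tX]\<close>)
    moreover have "Ck_on k D (\<lambda>u. t (X u) \<bullet> v)" for v
      by (rule Ck_on_bounded_linear[OF \<open>open D\<close> bounded_linear_inner_left tX])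
    ultimately have "Ck_on k D (\<lambda>u. P w + (- ((t (X u) \<bullet> P w) * (t (X u) \<bullet> e\<^sub>3) powr (-1))) *\<^sub>R e\<^sub>3)" for w
      by (intro Ck_on_add[OF \<open>open D\<close>] Ck_on_const
          Ck_on_bounded_bilinear[OF \<open>open D\<close> bounded_bilinear_mult]
          Ck_on_bounded_linear[OF \<open>open D\<close> bounded_linear_scaleR_left]
          Ck_on_bounded_linear[OF \<open>open D\<close> bounded_linear_minus[OF bounded_linear_ident]])
    then show ?case
      by (intro Ck_on_SucI[OF \<open>open D\<close> dX]) (simp_all add: X'_def)
  qed
  then have smooth: "smooth_on D X"
    by (simp add: smooth_on_def)
  have inj: "inj (frechet_derivative X (at u))" if "u \<in> D" for u
  proof -
    have "w = vector [e\<^sub>1 \<bullet> X' u w, e\<^sub>2 \<bullet> X' u w]" for w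
      by (simp add: X'_def P_def vec_eq_iff forall_2 inner_add_right inner_diff_right ip sq)
    then have "inj (X' u)"
      by (metis injI)
    then show ?thesis
      using frechet_derivative_at[OF dX[OF that]] by simp
  qed
  have "continuous_on S Y"
    by (rule continuous_on_eq[of _ "\<lambda>x. (e\<^sub>1 \<bullet> (x - q)) *\<^sub>R axis 1 1 + (e\<^sub>2 \<bullet> (x - q)) *\<^sub>R axis 2 1"])
      (auto intro!: continuous_intros simp: Y_def vec_eq_iff forall_2 axis_def)
  then have "homeomorphism D (S \<inter> UNIV) X Y"
    using YX smooth_on_continuous_on[OF smooth] by (auto simp: homeomorphism_def S_def image_image)
  then have "regular_surface S"
    unfolding regular_surface_def using \<open>open D\<close> smooth inj by blast
  moreover have "q \<in> S" "S \<subseteq> V"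
    using q XV V' by (auto simp: S_def)
  moreover have "unit_normal_on S t"
    unfolding unit_normal_on_def tangent_vectors_def
  proof safe
    fix x assume "x \<in> S"
    then show "norm (t x) = 1" using unit \<open>S \<subseteq> V\<close> by blast
  next
    fix w e and \<gamma> :: "real \<Rightarrow> real^3"
    assume "0 < e" and \<gamma>S: "\<gamma> ` {-e<..<e} \<subseteq> S" and S: "\<gamma> 0 \<in> S"
      and \<gamma>: "(\<gamma> has_vector_derivative w) (at 0)"
    have \<phi>\<gamma>: "\<phi> (\<gamma> s) = \<phi> q" if "s \<in> {-e<..<e}" for s
    proof -
      have "\<gamma> s \<in> X ` D"
        using \<gamma>S that unfolding S_def by blast
      then show ?thesis by (auto simp: \<phi>X)
    qed
    have "((\<lambda>s. \<phi> (\<gamma> s)) has_derivative (\<lambda>r. t (\<gamma> 0) \<bullet> (r *\<^sub>R w))) (at 0)"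
      using \<gamma> S \<open>S \<subseteq> V\<close> unfolding has_vector_derivative_def
      by (intro has_derivative_compose[OF _ \<phi>]) auto
    moreover have "((\<lambda>s. \<phi> (\<gamma> s)) has_derivative (\<lambda>r. 0)) (at 0)"
      by (rule has_derivative_transform_within_open[OF has_derivative_const, of "{-e<..<e}" _ "\<phi> q"])
        (use \<open>0 < e\<close> in \<open>auto simp: \<phi>\<gamma>\<close>)
    ultimately have "(\<lambda>r. t (\<gamma> 0) \<bullet> (r *\<^sub>R w)) = (\<lambda>r. 0)"
      by (rule has_derivative_unique)
    from fun_cong[OF this, of 1] show "w \<bullet> t (\<gamma> 0) = 0"
      by (simp add: inner_commute)
  qed
  ultimately show ?thesis
    using that by blast
qed

section \<open>Principal directions\<close>

lemma linear_dir_deriv: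
  "smooth_on S t \<Longrightarrow> x \<in> S \<Longrightarrow> linear (\<lambda>w. dir_deriv w t x)"
  unfolding dir_deriv_def by (rule has_derivative_linear[OF smooth_on_has_derivative])

lemma smooth_on_dir_deriv_field:
  fixes t :: "'a::euclidean_space \<Rightarrow> 'b::real_normed_vector"
  assumes "open S" "smooth_on S t" "smooth_on S w"
  shows "smooth_on S (\<lambda>x. dir_deriv (w x) t x)"
proof (rule smooth_on_cong[OF \<open>open S\<close>])
  show "smooth_on S (\<lambda>x. \<Sum>b\<in>Basis. (w x \<bullet> b) *\<^sub>R dir_deriv b t x)"
    using assms by (intro smooth_on_sum smooth_on_scaleR smooth_on_inner smooth_on_dir_deriv smooth_on_const)
  fix x assume "x \<in> S"
  interpret linear "\<lambda>w. dir_deriv w t x"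
    using assms \<open>x \<in> S\<close> by (intro linear_dir_deriv)
  show "(\<Sum>b\<in>Basis. (w x \<bullet> b) *\<^sub>R dir_deriv b t x) = dir_deriv (w x) t x"
    using sum[of "\<lambda>b. (w x \<bullet> b) *\<^sub>R b" Basis] unfolding euclidean_representation scaleR by (rule sym)
qed

lemma dir_deriv_symmetric:
  assumes "smooth_on S t" "x \<in> S" "curl t x = 0"
  shows "u \<bullet> dir_deriv w t x = w \<bullet> dir_deriv u t x"
  using inner_curl_cross[OF smooth_on_has_derivative[OF assms(1,2)], of w u] assms(3)
  by (simp add: dir_deriv_def)

lemma inner_cross_swap:
  fixes n :: "real^3"
  shows "n \<bullet> (t \<times> w) = - ((t \<times> n) \<bullet> w)"
  by (simp add: cross3_simps)

text \<open>The explicit eigenvector of a symmetric matrix of size two. In the basis $(e, t \<times> e)$ the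
  trace-free part of $D$ has the rows $(\<delta>, c)$ and $(c, -\<delta>)$, with eigenvalues $\<plusminus>r$ where
  $r^2 = \<delta>^2 + c^2$; the vector $(\<delta> + r, c)$ is an eigenvector for $r$. It may vanish, and the
  equation holds trivially then. The scalar $k$ is there for normalization.\<close>

lemma principal_combination:
  fixes D :: "real^3 \<Rightarrow> real^3"
  assumes "linear D" "norm t = 1" "norm e = 1" "t \<bullet> e = 0"
    and sym: "e \<bullet> D (t \<times> e) = (t \<times> e) \<bullet> D e"
    and \<delta>: "2 * \<delta> = e \<bullet> D e - (t \<times> e) \<bullet> D (t \<times> e)"
    and c: "c = e \<bullet> D (t \<times> e)"
    and r: "r\<^sup>2 = \<delta>\<^sup>2 + c\<^sup>2"
  shows "(k *\<^sub>R ((\<delta> + r) *\<^sub>R e + c *\<^sub>R (t \<times> e))) \<bullet>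
    (t \<times> D (k *\<^sub>R ((\<delta> + r) *\<^sub>R e + c *\<^sub>R (t \<times> e)))) = 0"
proof -
  interpret linear D by fact
  have "t \<times> (t \<times> e) = - e"
    using assms by (simp add: Lagrange dot_square_norm)
  then have "(t \<times> ((\<delta> + r) *\<^sub>R e + c *\<^sub>R (t \<times> e))) \<bullet> D ((\<delta> + r) *\<^sub>R e + c *\<^sub>R (t \<times> e))
      = (\<delta> + r)\<^sup>2 * c - (\<delta> + r) * c * (2 * \<delta>) - c\<^sup>2 * c"
    unfolding \<delta> c add scaleR cross_add_right cross_mult_right using sym
    by (simp add: inner_add_left inner_add_right inner_diff_left inner_diff_right algebra_simps power2_eq_square)
  also have "\<dots> = (r\<^sup>2 - \<delta>\<^sup>2 - c\<^sup>2) * c"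
    by (simp add: algebra_simps power2_eq_square)
  finally show ?thesis
    unfolding inner_cross_swap scaleR cross_mult_right inner_scaleR_left inner_scaleR_right
    by (simp add: r)
qed

lemma principal_direction_exists:
  fixes D :: "real^3 \<Rightarrow> real^3"
  assumes "linear D" "norm t = 1" and sym: "\<And>u w. u \<bullet> D w = w \<bullet> D u"
  obtains n where "norm n = 1" "t \<bullet> n = 0" "n \<bullet> (t \<times> D n) = 0"
proof -
  obtain a where a: "norm a = 1" "a \<times> t \<noteq> 0"
    using exists_not_parallel[OF assms(2)] .
  define e where "e = (a \<times> t) /\<^sub>R norm (a \<times> t)"
  have e: "norm e = 1" "t \<bullet> e = 0"
    using a by (simp_all add: e_def dot_cross_self)
  define c where "c = e \<bullet> D (t \<times> e)"
  define \<delta> where "\<delta> = (e \<bullet> D e - (t \<times> e) \<bullet> D (t \<times> e)) / 2"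
  define m where "m = (\<delta> + sqrt (\<delta>\<^sup>2 + c\<^sup>2)) *\<^sub>R e + c *\<^sub>R (t \<times> e)"
  show ?thesis
  \<comment> \<open>The formula for the eigenvector can only give zero when c = 0, and e itself is principal then.\<close>
  proof (cases "c = 0")
    case True
    then have "e \<bullet> (t \<times> D e) = 0"
      using sym[of e "t \<times> e"] by (simp add: inner_cross_swap c_def)
    with e show ?thesis by (rule that)
  next
    case False
    have "(t \<times> e) \<bullet> (t \<times> e) = 1"
      using norm_cross_dot[of t e] e assms(2) by (simp add: power2_norm_eq_inner)
    then have "m \<bullet> (t \<times> e) = c"
      by (simp add: m_def inner_add_left dot_cross_self)
    then have "m \<noteq> 0" using False by auto
    moreover have "t \<bullet> m = 0"
      using e by (simp add: m_def inner_add_right dot_cross_self)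
    moreover have "(inverse (norm m) *\<^sub>R m) \<bullet> (t \<times> D (inverse (norm m) *\<^sub>R m)) = 0"
      unfolding m_def
      by (rule principal_combination[OF assms(1,2) e sym _ c_def]) (simp_all add: \<delta>_def)
    ultimately show ?thesis
      by (intro that[of "inverse (norm m) *\<^sub>R m"]) simp_all
  qed
qed

text \<open>By linearity it is enough to test the derivative on one orthonormal basis $(e, t \<times> e)$ of the
  plane orthogonal to $t$; the hypotheses say that its matrix there is a multiple of the identity.\<close>

lemma umbilicI:
  fixes t :: "real^3 \<Rightarrow> real^3"
  assumes "linear (\<lambda>w. dir_deriv w t x)" "norm (t x) = 1" "norm e = 1" "t x \<bullet> e = 0"
    and "\<And>w. t x \<bullet> dir_deriv w t x = 0"
    and "e \<bullet> dir_deriv e t x = (t x \<times> e) \<bullet> dir_deriv (t x \<times> e) t x"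
    and "e \<bullet> dir_deriv (t x \<times> e) t x = 0" "(t x \<times> e) \<bullet> dir_deriv e t x = 0"
  shows "umbilic_at t x"
  unfolding umbilic_at_def
proof (intro exI allI impI)
  fix w assume w: "w \<bullet> t x = 0"
  interpret linear "\<lambda>w. dir_deriv w t x" by fact
  define c where "c = e \<bullet> dir_deriv e t x"
  note ex = orthonormal_triple_expansion[OF assms(2-4)]
  have "dir_deriv e t x = c *\<^sub>R e"
    using ex[of "dir_deriv e t x"] unfolding assms(5,8) scaleR_zero_left add_0_right c_def .
  moreover have "dir_deriv (t x \<times> e) t x = c *\<^sub>R (t x \<times> e)"
    using ex[of "dir_deriv (t x \<times> e) t x"]
    unfolding assms(5,7) assms(6)[symmetric] scaleR_zero_left add_0_right add_0_left c_def .
  moreover have w_eq: "w = (e \<bullet> w) *\<^sub>R e + ((t x \<times> e) \<bullet> w) *\<^sub>R (t x \<times> e)"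
    using ex[of w] w by (simp add: inner_commute)
  ultimately have "dir_deriv w t x = (e \<bullet> w) *\<^sub>R c *\<^sub>R e + ((t x \<times> e) \<bullet> w) *\<^sub>R c *\<^sub>R (t x \<times> e)"
    by (metis add scaleR)
  also have "\<dots> = c *\<^sub>R ((e \<bullet> w) *\<^sub>R e + ((t x \<times> e) \<bullet> w) *\<^sub>R (t x \<times> e))"
    by (simp add: algebra_simps)
  finally show "dir_deriv w t x = (e \<bullet> dir_deriv e t x) *\<^sub>R w"
    unfolding c_def w_eq[symmetric] .
qed

text \<open>Away from umbilic points the two principal curvatures differ, so the square root $r$ is taken of
  a positive function and is smooth. The sign condition on the diagonal of the shape operator at $p$
  makes $\<delta> + r$ positive near $p$, so that the explicit eigenvector can be normalized there.\<close>

lemma smooth_principal_field: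
  assumes "open V" "p \<in> V" and t: "smooth_on V t"
    and unit: "\<And>x. x \<in> V \<Longrightarrow> norm (t x) = 1" and curl: "\<And>x. x \<in> V \<Longrightarrow> curl t x = 0"
    and nonumb: "\<And>x. x \<in> V \<Longrightarrow> \<not> umbilic_at t x"
    and e: "smooth_on V e" "\<And>x. x \<in> V \<Longrightarrow> norm (e x) = 1" "\<And>x. x \<in> V \<Longrightarrow> t x \<bullet> e x = 0"
    and ge: "(t p \<times> e p) \<bullet> dir_deriv (t p \<times> e p) t p \<le> e p \<bullet> dir_deriv (e p) t p"
  obtains V' n where "open V'" "p \<in> V'" "V' \<subseteq> V" "smooth_on V' n"
    "\<And>x. x \<in> V' \<Longrightarrow> norm (n x) = 1 \<and> t x \<bullet> n x = 0 \<and> n x \<bullet> (t x \<times> dir_deriv (n x) t x) = 0"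
proof -
  define c where "c x = e x \<bullet> dir_deriv (t x \<times> e x) t x" for x
  define \<delta> where "\<delta> x = (1/2) * (e x \<bullet> dir_deriv (e x) t x - (t x \<times> e x) \<bullet> dir_deriv (t x \<times> e x) t x)" for x
  define r where "r x = (\<delta> x * \<delta> x + c x * c x) powr (1/2)" for x
  define m where "m x = (\<delta> x + r x) *\<^sub>R e x + c x *\<^sub>R (t x \<times> e x)" for x
  define V' where "V' = V \<inter> (\<lambda>x. \<delta> x + r x) -` {0<..}"
  have sym: "u \<bullet> dir_deriv w t x = w \<bullet> dir_deriv u t x" if "x \<in> V" for u w x
    by (rule dir_deriv_symmetric[OF t that curl[OF that]])
  have pos: "0 < \<delta> x * \<delta> x + c x * c x" if x: "x \<in> V" for x
  proof (rule ccontr)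
    assume "\<not> ?thesis"
    then have "\<delta> x = 0" "c x = 0"
      by (simp_all add: not_less sum_squares_le_zero_iff)
    then have "umbilic_at t x"
      using unit_inner_derivative[OF smooth_on_has_derivative[OF t x] \<open>open V\<close> x unit] sym[OF x]
      by (intro umbilicI[OF linear_dir_deriv[OF t x] unit[OF x] e(2)[OF x] e(3)[OF x]])
        (auto simp: c_def \<delta>_def dir_deriv_def[symmetric])
    with nonumb[OF x] show False ..
  qed
  have c: "smooth_on V c" and \<delta>: "smooth_on V \<delta>"
    unfolding c_def[abs_def] \<delta>_def[abs_def]
    by (intro smooth_on_inner smooth_on_dir_deriv_field smooth_on_mult smooth_on_diff smooth_on_cross
        smooth_on_const t e \<open>open V\<close>)+
  have "smooth_on V r"
    unfolding r_def[abs_def] by (intro smooth_on_powr smooth_on_add smooth_on_mult c \<delta> \<open>open V\<close> pos)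
  with \<delta> have \<delta>r: "smooth_on V (\<lambda>x. \<delta> x + r x)"
    by (intro smooth_on_add \<open>open V\<close>)
  have m: "smooth_on V m"
    unfolding m_def[abs_def]
    by (intro smooth_on_add smooth_on_scaleR smooth_on_cross c \<delta>r t e \<open>open V\<close>)
  have "open V'"
    unfolding V'_def
    by (intro continuous_open_preimage smooth_on_continuous_on \<delta>r \<open>open V\<close> open_greaterThan)
  moreover have "0 < r p"
    using pos[OF \<open>p \<in> V\<close>] by (auto simp: r_def)
  with ge have "p \<in> V'"
    using \<open>p \<in> V\<close> by (simp add: V'_def \<delta>_def add_nonneg_pos)
  moreover have sub: "V' \<subseteq> V" by (auto simp: V'_def)
  moreover have m0: "m x \<noteq> 0" if "x \<in> V'" for x
  proof -
    have "e x \<bullet> m x = \<delta> x + r x"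
      using e(2)[of x] that sub by (auto simp: m_def inner_add_right dot_cross_self dot_square_norm)
    then show ?thesis using that by (auto simp: V'_def)
  qed
  then have "smooth_on V' (unit_field m)"
    by (intro smooth_on_unit_field smooth_on_subset[OF m sub] \<open>open V'\<close>)
  moreover have "norm (unit_field m x) = 1 \<and> t x \<bullet> unit_field m x = 0 \<and>
    unit_field m x \<bullet> (t x \<times> dir_deriv (unit_field m x) t x) = 0" if "x \<in> V'" for x
  proof (intro conjI)
    have x: "x \<in> V" using that sub by blast
    show "norm (unit_field m x) = 1"
      using m0[OF that] by (simp add: unit_field_def)
    show "t x \<bullet> unit_field m x = 0"
      using e(3)[OF x] by (simp add: unit_field_def m_def inner_add_right dot_cross_self)
    have "(r x)\<^sup>2 = (\<delta> x)\<^sup>2 + (c x)\<^sup>2"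
      using pos[OF x] by (simp add: r_def powr_half_sqrt power2_eq_square)
    then show "unit_field m x \<bullet> (t x \<times> dir_deriv (unit_field m x) t x) = 0"
      unfolding unit_field_def m_def
      by (intro principal_combination[OF linear_dir_deriv[OF t x] unit[OF x] e(2)[OF x] e(3)[OF x] sym[OF x]])
        (simp_all add: c_def \<delta>_def)
  qed
  ultimately show ?thesis by (rule that)
qed

lemma not_parallel_near:
  assumes "open W" "smooth_on W t" "p \<in> W" "a \<times> t p \<noteq> 0"
  obtains V where "open V" "p \<in> V" "V \<subseteq> W" "\<And>x. x \<in> V \<Longrightarrow> a \<times> t x \<noteq> 0"
proof
  have "continuous_on W (\<lambda>x. a \<times> t x)"
    by (intro smooth_on_continuous_on smooth_on_cross smooth_on_const assms)
  then show "open (W \<inter> (\<lambda>x. a \<times> t x) -` (- {0}))"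
    using \<open>open W\<close> by (rule continuous_open_preimage) auto
qed (use assms in auto)

text \<open>Inside the umbilic set every tangent direction is principal, and near a point outside
  its closure there is a smooth field of eigenvectors. On the boundary of the umbilic set neither argument applies; a
  principal direction is then chosen separately at each point.\<close>

lemma principal_field_near:
  assumes "open W" "p \<in> W" and t: "smooth_on W t"
    and unit: "\<And>x. x \<in> W \<Longrightarrow> norm (t x) = 1" and curl: "\<And>x. x \<in> W \<Longrightarrow> curl t x = 0"
  obtains V n where "open V" "p \<in> V" "V \<subseteq> W"
    "\<And>x. x \<in> V \<Longrightarrow> norm (n x) = 1 \<and> t x \<bullet> n x = 0 \<and> n x \<bullet> (t x \<times> dir_deriv (n x) t x) = 0"
    "p \<notin> frontier {x \<in> W. umbilic_at t x} \<Longrightarrow> smooth_on V n"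
proof -
  let ?M = "{x \<in> W. umbilic_at t x}"
  obtain a where a: "norm a = 1" "a \<times> t p \<noteq> 0"
    using exists_not_parallel[OF unit[OF \<open>p \<in> W\<close>]] .
  define e where "e = unit_field (\<lambda>x. a \<times> t x)"
  obtain W' where W': "open W'" "p \<in> W'" "W' \<subseteq> W" and nz: "\<And>x. x \<in> W' \<Longrightarrow> a \<times> t x \<noteq> 0"
    using not_parallel_near[OF \<open>open W\<close> t \<open>p \<in> W\<close> a(2)] by blast
  have "smooth_on W' e"
    unfolding e_def
    by (intro smooth_on_unit_field smooth_on_cross smooth_on_const smooth_on_subset[OF t W'(3)] W'(1) nz)
  moreover have "\<And>x. x \<in> W' \<Longrightarrow> norm (e x) = 1" "\<And>x. x \<in> W' \<Longrightarrow> t x \<bullet> e x = 0"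
    using nz by (auto simp: e_def unit_field_def dot_cross_self)
  ultimately have e: "smooth_on W' e" "\<And>x. x \<in> W' \<Longrightarrow> norm (e x) = 1" "\<And>x. x \<in> W' \<Longrightarrow> t x \<bullet> e x = 0"
    by auto
  consider "p \<in> frontier ?M" | "p \<in> interior ?M" | "p \<notin> closure ?M"
    by (auto simp: frontier_def)
  then show ?thesis
  proof cases
    case 1
    have "\<exists>n. x \<in> W \<longrightarrow> norm n = 1 \<and> t x \<bullet> n = 0 \<and> n \<bullet> (t x \<times> dir_deriv n t x) = 0" for x
      by (metis principal_direction_exists[OF linear_dir_deriv[OF t] unit dir_deriv_symmetric[OF t _ curl]])
    then obtain n where "\<And>x. x \<in> W \<Longrightarrow> norm (n x) = 1 \<and> t x \<bullet> n x = 0 \<and> n x \<bullet> (t x \<times> dir_deriv (n x) t x) = 0"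
      by metis
    with 1 show ?thesis
      by (intro that[OF \<open>open W\<close> \<open>p \<in> W\<close> subset_refl]) auto
  next
    case 2
    have "e x \<bullet> (t x \<times> dir_deriv (e x) t x) = 0" if "x \<in> W' \<inter> interior ?M" for x
    proof -
      have "umbilic_at t x" using that interior_subset by blast
      moreover have "e x \<bullet> t x = 0"
        using e(3)[of x] that by (simp add: inner_commute)
      ultimately obtain c where "dir_deriv (e x) t x = c *\<^sub>R e x"
        unfolding umbilic_at_def by blast
      then show ?thesis by (simp add: cross_mult_right dot_cross_self)
    qed
    with 2 W' e show ?thesis
      by (intro that[of "W' \<inter> interior ?M" e]) (auto intro: smooth_on_subset[OF e(1)])
  next
    case 3
    define Z where "Z = W' - closure ?M"
    have Z: "open Z" "p \<in> Z" "Z \<subseteq> W'" "Z \<subseteq> W"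
      using 3 W' by (auto simp: Z_def)
    have nonumb: "\<not> umbilic_at t x" if "x \<in> Z" for x
      using that closure_subset[of ?M] W'(3) by (auto simp: Z_def)
    note tZ = smooth_on_subset[OF t Z(4)]
    have lin: "linear (\<lambda>w. dir_deriv w t p)"
      by (rule linear_dir_deriv[OF t \<open>p \<in> W\<close>])
    have te: "t x \<times> (t x \<times> e x) = - e x" "norm (t x \<times> e x) = 1" if "x \<in> Z" for x
    proof -
      have x: "norm (t x) = 1" "norm (e x) = 1" "t x \<bullet> e x = 0"
        using that Z e unit by auto
      then show "t x \<times> (t x \<times> e x) = - e x"
        by (simp add: Lagrange dot_square_norm)
      show "norm (t x \<times> e x) = 1"
        using orthonormal_frameI[of "{x}" t e] x by (simp add: orthonormal_frame_on_def)
    qed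
    \<comment> \<open>Turning the frame by a right angle exchanges the diagonal entries of the shape operator, so one
      of the two fields satisfies the sign condition at p.\<close>
    obtain f where "smooth_on Z f" "\<And>x. x \<in> Z \<Longrightarrow> norm (f x) = 1" "\<And>x. x \<in> Z \<Longrightarrow> t x \<bullet> f x = 0"
      and "(t p \<times> f p) \<bullet> dir_deriv (t p \<times> f p) t p \<le> f p \<bullet> dir_deriv (f p) t p"
    proof (cases "(t p \<times> e p) \<bullet> dir_deriv (t p \<times> e p) t p \<le> e p \<bullet> dir_deriv (e p) t p")
      case True
      then show ?thesis
        using e Z by (intro that[of e]) (auto intro: smooth_on_subset[OF e(1)])
    next
      case False
      then show ?thesis
        using te Z linear_neg[OF lin, of "e p"]
        by (intro that[of "\<lambda>x. t x \<times> e x"])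
          (auto simp: dot_cross_self intro!: smooth_on_cross tZ smooth_on_subset[OF e(1)])
    qed
    from smooth_principal_field[OF Z(1,2) tZ unit curl nonumb this]
    obtain V n where "open V" "p \<in> V" "V \<subseteq> Z" "smooth_on V n"
      "\<And>x. x \<in> V \<Longrightarrow> norm (n x) = 1 \<and> t x \<bullet> n x = 0 \<and> n x \<bullet> (t x \<times> dir_deriv (n x) t x) = 0"
      using Z(4) by blast
    with Z(4) show ?thesis by (intro that[of V n]) auto
  qed
qed

section \<open>Adapted frames of a unit field\<close>

text \<open>A curl-free unit field is locally the gradient of a function, and the level sets of this function
  are the surfaces with unit normal $t$. One field $n$ serves all these level sets simultaneously.\<close>

lemma darboux_frame_near:
  assumes "open W" "p \<in> W" and t: "smooth_on W t"
    and unit: "\<And>x. x \<in> W \<Longrightarrow> norm (t x) = 1" and curl: "\<And>x. x \<in> W \<Longrightarrow> curl t x = 0"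
  obtains V n where "open V" "p \<in> V" "V \<subseteq> W"
    "\<And>q. q \<in> V \<Longrightarrow> \<exists>S. q \<in> S \<and> S \<subseteq> V \<and> darboux_frame_on S t n (\<lambda>x. t x \<times> n x)"
    "p \<notin> frontier {x \<in> W. umbilic_at t x} \<Longrightarrow> smooth_frame_on V t n (\<lambda>x. t x \<times> n x)"
proof -
  from principal_field_near[OF \<open>open W\<close> \<open>p \<in> W\<close> t unit curl]
  obtain V n where V: "open V" "p \<in> V" "V \<subseteq> W"
    and n: "\<And>x. x \<in> V \<Longrightarrow> norm (n x) = 1 \<and> t x \<bullet> n x = 0 \<and> n x \<bullet> (t x \<times> dir_deriv (n x) t x) = 0"
    and smooth: "p \<notin> frontier {x \<in> W. umbilic_at t x} \<Longrightarrow> smooth_on V n"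
    by blast
  obtain d where d: "0 < d" "ball p d \<subseteq> V"
    using V openE by blast
  let ?B = "ball p d"
  have BW: "?B \<subseteq> W" using d V by blast
  have "u \<bullet> dir_deriv w t x = w \<bullet> dir_deriv u t x" if "x \<in> ?B" for x u w
    using that BW by (intro dir_deriv_symmetric[OF t] curl) auto
  with symmetric_derivative_potential[OF open_ball convex_ball _ smooth_on_subset[OF t BW]] d(1)
  obtain \<phi> where \<phi>: "\<And>x. x \<in> ?B \<Longrightarrow> (\<phi> has_derivative (\<lambda>h. t x \<bullet> h)) (at x)"
    by (metis centre_in_ball)
  show ?thesis
  proof (rule that[OF open_ball _ BW])
    show "p \<in> ?B" using d by simp
    show "\<exists>S. q \<in> S \<and> S \<subseteq> ?B \<and> darboux_frame_on S t n (\<lambda>x. t x \<times> n x)" if q: "q \<in> ?B" for q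
    proof -
      obtain S where S: "q \<in> S" "S \<subseteq> ?B" "regular_surface S" "unit_normal_on S t"
        using level_surface_through[OF open_ball q smooth_on_subset[OF t BW] _ \<phi>] unit BW by blast
      have "orthonormal_frame_on S t n (\<lambda>x. t x \<times> n x)"
        using S(2) BW d n unit by (intro orthonormal_frameI) auto
      moreover have "\<forall>x\<in>S. n x \<bullet> (t x \<times> dir_deriv (n x) t x) = 0"
        using S(2) d n by blast
      ultimately show ?thesis
        using S unfolding darboux_frame_on_def by blast
    qed
    show "smooth_frame_on ?B t n (\<lambda>x. t x \<times> n x)" if "p \<notin> frontier {x \<in> W. umbilic_at t x}"
      using smooth[OF that] d BW n unit
      by (intro smooth_frameI smooth_on_subset[OF t]) (auto intro: smooth_on_subset)
  qed
qed

theorem proposition1: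
  fixes U :: "(real^3) set" and v t :: "real^3 \<Rightarrow> real^3"
  assumes "open U" and "smooth_on U v" and "\<forall>x\<in>U. v x \<noteq> 0"
    and "t = unit_field v"
  shows "\<forall>W. open W \<and> W \<subseteq> U \<longrightarrow>
    \<comment> \<open>equivalence of the two forms of the condition in case 2\<close>
    (\<forall>n b. orthonormal_frame_on W t n b \<longrightarrow>
       (\<forall>x\<in>W. (hel n t x = 0 \<and> hel b t x = 0) \<longleftrightarrow> dir_deriv (t x) t x = 0)) \<and>
    \<comment> \<open>case 1\<close>
    ((\<forall>x\<in>W. curl t x \<times> t x \<noteq> 0) \<longrightarrow>
       (\<exists>n. n = unit_field (\<lambda>x. curl t x \<times> t x) \<and>
          smooth_frame_on W t n (\<lambda>x. t x \<times> n x) \<and> (\<forall>x\<in>W. hel n t x = 0))) \<and>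
    \<comment> \<open>case 2\<close>
    ((\<forall>x\<in>W. curl t x \<times> t x = 0) \<longrightarrow>
       (\<forall>x\<in>W. curl t x = hel t t x *\<^sub>R t x) \<and>
       (\<forall>n b. orthonormal_frame_on W t n b \<longrightarrow> (\<forall>x\<in>W. hel n t x = 0 \<and> hel b t x = 0)) \<and>
       (\<forall>x\<in>W. dir_deriv (t x) t x = 0) \<and>
       \<comment> \<open>case 2a\<close>
       ((\<forall>x\<in>W. gradient (hel t t) x \<times> t x \<noteq> 0) \<longrightarrow>
          (\<exists>n. n = unit_field (\<lambda>x. gradient (hel t t) x \<times> t x) \<and>
             smooth_frame_on W t n (\<lambda>x. t x \<times> n x))) \<and>
       \<comment> \<open>case 2b-i\<close>
       ((\<forall>x\<in>W. gradient (hel t t) x \<times> t x = 0) \<and> (\<exists>c. c \<noteq> 0 \<and> (\<forall>x\<in>W. hel t t x = c)) \<longrightarrow>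
          (\<forall>p\<in>W. \<exists>V a n b. open V \<and> p \<in> V \<and> V \<subseteq> W \<and> norm a = 1 \<and>
             (\<forall>x\<in>V. a \<times> t x \<noteq> 0) \<and> n = unit_field (\<lambda>x. a \<times> t x) \<and> b = (\<lambda>x. t x \<times> n x) \<and>
             smooth_frame_on V t n b \<and> (\<forall>x\<in>V. hel n t x = 0 \<and> hel b t x = 0))) \<and>
       \<comment> \<open>case 2b-ii\<close>
       ((\<forall>x\<in>W. gradient (hel t t) x \<times> t x = 0) \<and> (\<forall>x\<in>W. hel t t x = 0) \<longrightarrow>
          (\<forall>p\<in>W. \<exists>V n b. open V \<and> p \<in> V \<and> V \<subseteq> W \<and> b = (\<lambda>x. t x \<times> n x) \<and>
             (\<forall>q\<in>V. \<exists>S. q \<in> S \<and> S \<subseteq> V \<and> darboux_frame_on S t n b) \<and>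
             (\<forall>x\<in>V. hel n t x = 0 \<and> hel b t x = 0) \<and>
             (p \<notin> frontier {x\<in>W. umbilic_at t x} \<longrightarrow> smooth_frame_on V t n b))))"
proof (intro allI impI conjI)
  fix W assume "open W \<and> W \<subseteq> U"
  then have "open W" "W \<subseteq> U" by auto
  have unit: "norm (t x) = 1" if "x \<in> W" for x
    using assms(3,4) that \<open>W \<subseteq> U\<close> by (auto simp: unit_field_def)
  have t: "smooth_on W t"
    unfolding assms(4) using assms(3)
    by (intro smooth_on_subset[OF smooth_on_unit_field[OF assms(1,2)] \<open>W \<subseteq> U\<close>]) auto
  have curl: "smooth_on W (curl t)"
    by (rule smooth_on_curl[OF \<open>open W\<close> t])
  have ds: "dir_deriv (t x) t x = curl t x \<times> t x" if "x \<in> W" for x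
    unfolding dir_deriv_def
    using curl_cross_unit[OF smooth_on_has_derivative[OF t that] \<open>open W\<close> that unit] by simp

  show "\<forall>x\<in>W. (hel n t x = 0 \<and> hel b t x = 0) \<longleftrightarrow> dir_deriv (t x) t x = 0"
    if "orthonormal_frame_on W t n b" for n b
    using hel_eq_0_iff[OF that] ds by simp

  show "\<exists>n. n = unit_field (\<lambda>x. curl t x \<times> t x) \<and>
      smooth_frame_on W t n (\<lambda>x. t x \<times> n x) \<and> (\<forall>x\<in>W. hel n t x = 0)"
    if "\<forall>x\<in>W. curl t x \<times> t x \<noteq> 0"
    using smooth_frame_unit_field_cross[OF \<open>open W\<close> t unit curl] that
    by (simp add: hel_def unit_field_def dot_cross_self)

  assume parallel: "\<forall>x\<in>W. curl t x \<times> t x = 0"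
  have curl_eq: "curl t x = hel t t x *\<^sub>R t x" if "x \<in> W" for x
    using parallel_to_unit[OF unit[OF that]] parallel that by (simp add: hel_def)
  then show "\<forall>x\<in>W. curl t x = hel t t x *\<^sub>R t x" ..
  show "\<forall>x\<in>W. hel n t x = 0 \<and> hel b t x = 0" if "orthonormal_frame_on W t n b" for n b
    using hel_eq_0_iff[OF that] parallel by blast
  show "\<forall>x\<in>W. dir_deriv (t x) t x = 0"
    using ds parallel by simp

  show "\<exists>n. n = unit_field (\<lambda>x. gradient (hel t t) x \<times> t x) \<and>
      smooth_frame_on W t n (\<lambda>x. t x \<times> n x)"
    if "\<forall>x\<in>W. gradient (hel t t) x \<times> t x \<noteq> 0"
    using smooth_frame_unit_field_cross[OF \<open>open W\<close> t unit
        smooth_on_gradient[OF \<open>open W\<close> smooth_on_hel[OF \<open>open W\<close> t t]]] that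
    by simp

  show "\<forall>p\<in>W. \<exists>V a n b. open V \<and> p \<in> V \<and> V \<subseteq> W \<and> norm a = 1 \<and>
      (\<forall>x\<in>V. a \<times> t x \<noteq> 0) \<and> n = unit_field (\<lambda>x. a \<times> t x) \<and> b = (\<lambda>x. t x \<times> n x) \<and>
      smooth_frame_on V t n b \<and> (\<forall>x\<in>V. hel n t x = 0 \<and> hel b t x = 0)"
  proof
    fix p assume "p \<in> W"
    obtain a where a: "norm a = 1" "a \<times> t p \<noteq> 0"
      using exists_not_parallel[OF unit[OF \<open>p \<in> W\<close>]] .
    obtain V where V: "open V" "p \<in> V" "V \<subseteq> W" "\<And>x. x \<in> V \<Longrightarrow> a \<times> t x \<noteq> 0"
      using not_parallel_near[OF \<open>open W\<close> t \<open>p \<in> W\<close> a(2)] by blast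
    let ?n = "unit_field (\<lambda>x. a \<times> t x)"
    have "smooth_frame_on V t ?n (\<lambda>x. t x \<times> ?n x)"
      using V unit
      by (intro smooth_frame_unit_field_cross smooth_on_subset[OF t] smooth_on_const) auto
    moreover from this have "\<forall>x\<in>V. hel ?n t x = 0 \<and> hel (\<lambda>x. t x \<times> ?n x) t x = 0"
      using hel_eq_0_iff[of V t ?n] parallel V(3) by (auto simp: smooth_frame_on_def)
    ultimately show "\<exists>V a n b. open V \<and> p \<in> V \<and> V \<subseteq> W \<and> norm a = 1 \<and>
        (\<forall>x\<in>V. a \<times> t x \<noteq> 0) \<and> n = unit_field (\<lambda>x. a \<times> t x) \<and> b = (\<lambda>x. t x \<times> n x) \<and>
        smooth_frame_on V t n b \<and> (\<forall>x\<in>V. hel n t x = 0 \<and> hel b t x = 0)"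
      using V a by blast
  qed

  show "\<forall>p\<in>W. \<exists>V n b. open V \<and> p \<in> V \<and> V \<subseteq> W \<and> b = (\<lambda>x. t x \<times> n x) \<and>
      (\<forall>q\<in>V. \<exists>S. q \<in> S \<and> S \<subseteq> V \<and> darboux_frame_on S t n b) \<and>
      (\<forall>x\<in>V. hel n t x = 0 \<and> hel b t x = 0) \<and>
      (p \<notin> frontier {x\<in>W. umbilic_at t x} \<longrightarrow> smooth_frame_on V t n b)"
    if zero: "(\<forall>x\<in>W. gradient (hel t t) x \<times> t x = 0) \<and> (\<forall>x\<in>W. hel t t x = 0)"
  proof
    fix p assume "p \<in> W"
    have curl0: "curl t x = 0" if "x \<in> W" for x
      using curl_eq[OF that] zero that by simp
    from darboux_frame_near[OF \<open>open W\<close> \<open>p \<in> W\<close> t unit curl0]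
    obtain V n where V: "open V" "p \<in> V" "V \<subseteq> W"
      "\<And>q. q \<in> V \<Longrightarrow> \<exists>S. q \<in> S \<and> S \<subseteq> V \<and> darboux_frame_on S t n (\<lambda>x. t x \<times> n x)"
      "p \<notin> frontier {x \<in> W. umbilic_at t x} \<Longrightarrow> smooth_frame_on V t n (\<lambda>x. t x \<times> n x)"
      by blast
    have hel0: "\<forall>x\<in>V. hel n t x = 0 \<and> hel (\<lambda>x. t x \<times> n x) t x = 0"
      using V(3) curl0 by (auto simp: hel_def)
    show "\<exists>V n b. open V \<and> p \<in> V \<and> V \<subseteq> W \<and> b = (\<lambda>x. t x \<times> n x) \<and>
        (\<forall>q\<in>V. \<exists>S. q \<in> S \<and> S \<subseteq> V \<and> darboux_frame_on S t n b) \<and>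
        (\<forall>x\<in>V. hel n t x = 0 \<and> hel b t x = 0) \<and>
        (p \<notin> frontier {x\<in>W. umbilic_at t x} \<longrightarrow> smooth_frame_on V t n b)"
      by (rule exI[of _ V], rule exI[of _ n], rule exI[of _ "\<lambda>x. t x \<times> n x"])
        (intro conjI refl ballI impI V hel0[rule_format, THEN conjunct1] hel0[rule_format, THEN conjunct2])
  qed
qed

end
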